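(* Let $n$ be a positive integer, let $\mathcal{C}$ be the class of laminar matroids with at most $n$ elements, and let $\mathbb{F}$ be a field with at least $2^n$ elements. Then there is an online matroid morphism from $\mathcal{C}$ into the complete linear matroid $\mathbb{F}^n$.
   Context: A family $\mathcal{A}$ of sets is laminar if for any $A,A'\in\mathcal{A}$ at least one of $A\cap A'$, $A\setminus A'$, $A'\setminus A$ is empty. A matroid $\mathbf{M}$ is laminar if there are a laminar family $\mathcal{A}$ of subsets of its ground set and $c:\mathcal{A}\to\mathbb{Z}_+$ such that the independent sets are exactly the $I$ with $|I\cap A|\le c(A)$ for all $A\in\mathcal{A}$. $\mathbb{F}^n$ denotes the matroid whose ground set is all vectors of $\mathbb{F}^n$ with linear independence. A morphism $f:\mathbf{M}\to\mathbf{N}$ is a map of ground sets with $\mathrm{rank}_{\mathbf{N}}(f(S))=\mathrm{rank}_{\mathbf{M}}(S)$ for all $S$. An ordering of $\mathbf{M}$ with $|\mathbf{M}|=m$ is a bijection $\pi:[m]\to\mathbf{M}$; for $m'<m$ the prefix-restriction $(\mathbf{M}',\pi')$ is the restriction of $\mathbf{M}$ to $\pi([m'])$ with $\pi'=\pi|_{[m']}$. An online matroid morphism of $\mathcal{C}$ into $\mathbf{BigM}$ is a family of morphisms $f_{\mathbf{M},\pi}:\mathbf{M}\to\mathbf{BigM}$ for all $\mathbf{M}\in\mathcal{C}$ and orderings $\pi$, such that for every prefix-restriction $(\mathbf{M}',\pi')$ of $(\mathbf{M},\pi)$, $f_{\mathbf{M}',\pi'}$ is the restriction of $f_{\mathbf{M},\pi}$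 to $\mathbf{M}'$. *)

theory Defs
  imports "HOL-Analysis.Cartesian_Space" "HOL-Library.FuncSet"
begin

record 'a matroid =
  ground :: "'a set"
  indeps :: "'a set set"

text \<open>
  The ground set may be infinite (as for \<open>\<bbbF>\<^sup>n\<close> over an infinite field), but the rank is finite.
\<close>

locale matroid =
  fixes M :: "'a matroid"
  assumes indep_subset_ground: "I \<in> indeps M \<Longrightarrow> I \<subseteq> ground M"
    and indep_empty: "{} \<in> indeps M"
    and indep_mono: "I \<in> indeps M \<Longrightarrow> J \<subseteq> I \<Longrightarrow> J \<in> indeps M"
    and indep_augment: "I \<in> indeps M \<Longrightarrow> J \<in> indeps M \<Longrightarrow> card I < card J \<Longrightarrow>
      \<exists>x\<in>J - I. insert x I \<in> indeps M"
    and finite_rank: "\<exists>r. \<forall>I\<in>indeps M. finite I \<and> card I \<le> r"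

definition mrank :: "'a matroid \<Rightarrow> 'a set \<Rightarrow> nat" where
  "mrank M S = Max (card ` {I \<in> indeps M. I \<subseteq> S})"

definition restriction :: "'a matroid \<Rightarrow> 'a set \<Rightarrow> 'a matroid" where
  "restriction M S = \<lparr>ground = ground M \<inter> S, indeps = {I \<in> indeps M. I \<subseteq> S}\<rparr>"

definition matroid_morphism :: "'a matroid \<Rightarrow> 'b matroid \<Rightarrow> ('a \<Rightarrow> 'b) \<Rightarrow> bool" where
  "matroid_morphism M N f \<longleftrightarrow>
     f \<in> ground M \<rightarrow> ground N \<and> (\<forall>S\<subseteq>ground M. mrank N (f ` S) = mrank M S)"

definition laminar_family :: "'a set set \<Rightarrow> bool" where
  "laminar_family \<A> \<longleftrightarrow> (\<forall>A\<in>\<A>. \<forall>B\<in>\<A>. A \<inter> B = {} \<or> A - B = {} \<or> B - A = {})"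

text \<open>
  Capacities may be \<open>0\<close>, so loops are allowed. The finiteness conjunct is needed because
  \<^const>\<open>card\<close> is \<open>0\<close> on infinite sets; it is vacuous on a finite ground set.
\<close>

definition laminar_matroid :: "'a matroid \<Rightarrow> bool" where
  "laminar_matroid M \<longleftrightarrow> matroid M \<and>
     (\<exists>\<A> (c :: 'a set \<Rightarrow> nat). \<A> \<subseteq> Pow (ground M) \<and> laminar_family \<A> \<and>
        indeps M = {I. I \<subseteq> ground M \<and> (\<forall>A\<in>\<A>. finite (I \<inter> A) \<and> card (I \<inter> A) \<le> c A)})"

definition laminar_class :: "nat \<Rightarrow> 'a matroid set" where
  "laminar_class n = {M. laminar_matroid M \<and> finite (ground M) \<and> card (ground M) \<le> n}"

definition complete_linear_matroid :: "('f::field ^ 'n) matroid" where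
  "complete_linear_matroid = \<lparr>ground = UNIV, indeps = {S. vec.independent S}\<rparr>"

text \<open>
  Orderings are functions on \<open>{1..m}\<close>, taken extensional so that distinct values of the variable
  \<open>\<pi>\<close> are distinct bijections.
\<close>

definition matroid_ordering :: "'a matroid \<Rightarrow> (nat \<Rightarrow> 'a) \<Rightarrow> bool" where
  "matroid_ordering M \<pi> \<longleftrightarrow> finite (ground M) \<and> \<pi> \<in> extensional {1..card (ground M)} \<and>
     bij_betw \<pi> {1..card (ground M)} (ground M)"

definition prefix_restriction ::
  "'a matroid \<Rightarrow> (nat \<Rightarrow> 'a) \<Rightarrow> 'a matroid \<Rightarrow> (nat \<Rightarrow> 'a) \<Rightarrow> bool" where
  "prefix_restriction M' \<pi>' M \<pi> \<longleftrightarrow>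
     (\<exists>m' < card (ground M). M' = restriction M (\<pi> ` {1..m'}) \<and> \<pi>' = restrict \<pi> {1..m'})"

text \<open>
  Intended for classes closed under prefix-restrictions; \<open>laminar_class_prefix\<close> below gives
  this closure for the class of laminar matroids.
\<close>

definition online_matroid_morphism ::
  "'a matroid set \<Rightarrow> 'b matroid \<Rightarrow> ('a matroid \<Rightarrow> (nat \<Rightarrow> 'a) \<Rightarrow> 'a \<Rightarrow> 'b) \<Rightarrow> bool" where
  "online_matroid_morphism \<C> N f \<longleftrightarrow>
     (\<forall>M\<in>\<C>. \<forall>\<pi>. matroid_ordering M \<pi> \<longrightarrow>
        matroid_morphism M N (f M \<pi>) \<and>
        (\<forall>M' \<pi>'. prefix_restriction M' \<pi>' M \<pi> \<longrightarrow>
           (\<forall>x\<in>ground M'. f M' \<pi>' x = f M \<pi> x)))"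

lemma matroid_restriction:
  assumes "matroid M"
  shows "matroid (restriction M S)"
proof -
  interpret matroid M by fact
  obtain r where r: "\<forall>I\<in>indeps M. finite I \<and> card I \<le> r"
    using finite_rank by blast
  show ?thesis
  proof
    fix I J
    assume "I \<in> indeps (restriction M S)" "J \<in> indeps (restriction M S)" "card I < card J"
    then show "\<exists>x\<in>J - I. insert x I \<in> indeps (restriction M S)"
      using indep_augment[of I J] by (auto simp: restriction_def)
  next
    show "\<exists>r. \<forall>I\<in>indeps (restriction M S). finite I \<and> card I \<le> r"
      using r by (auto simp: restriction_def)
  qed (auto simp: restriction_def indep_empty dest: indep_subset_ground intro: indep_mono)
qed

lemma laminar_matroid_restriction:
  assumes "laminar_matroid M"
  shows "laminar_matroid (restriction M S)"
proof -
  obtain \<A> and c :: "'a set \<Rightarrow> nat" where A: "\<A> \<subseteq> Pow (ground M)" "laminar_family \<A>"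
    and I: "indeps M = {I. I \<subseteq> ground M \<and> (\<forall>A\<in>\<A>. finite (I \<inter> A) \<and> card (I \<inter> A) \<le> c A)}"
    and M: "matroid M"
    using assms unfolding laminar_matroid_def by blast
  define \<B> where "\<B> = (\<lambda>A. A \<inter> S) ` \<A>"
  define d where "d B = (LEAST k. \<exists>A\<in>\<A>. A \<inter> S = B \<and> c A = k)" for B
  have d_le: "d (A \<inter> S) \<le> c A" if "A \<in> \<A>" for A
    unfolding d_def using that by (intro Least_le) blast
  have d_eq: "\<exists>A'\<in>\<A>. A' \<inter> S = A \<inter> S \<and> c A' = d (A \<inter> S)" if "A \<in> \<A>" for A
    unfolding d_def by (rule LeastI_ex) (use that in blast)
  have "\<B> \<subseteq> Pow (ground (restriction M S))"
    using A(1) by (auto simp: \<B>_def restriction_def)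
  moreover have "laminar_family \<B>"
    unfolding laminar_family_def
  proof (intro ballI)
    fix X Y assume "X \<in> \<B>" "Y \<in> \<B>"
    then obtain A B where AB: "A \<in> \<A>" "B \<in> \<A>" "X = A \<inter> S" "Y = B \<inter> S"
      by (auto simp: \<B>_def)
    then have "A \<inter> B = {} \<or> A - B = {} \<or> B - A = {}"
      using A(2) by (auto simp: laminar_family_def)
    then show "X \<inter> Y = {} \<or> X - Y = {} \<or> Y - X = {}"
      unfolding AB by blast
  qed
  moreover have "J \<in> indeps (restriction M S) \<longleftrightarrow> J \<subseteq> ground (restriction M S) \<and>
      (\<forall>B\<in>\<B>. finite (J \<inter> B) \<and> card (J \<inter> B) \<le> d B)" for J
  proof (cases "J \<subseteq> S")
    case True
    then have *: "J \<inter> A = J \<inter> (A \<inter> S)" for A by blast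
    have "(\<forall>A\<in>\<A>. finite (J \<inter> A) \<and> card (J \<inter> A) \<le> c A) \<longleftrightarrow>
      (\<forall>A\<in>\<A>. finite (J \<inter> (A \<inter> S)) \<and> card (J \<inter> (A \<inter> S)) \<le> d (A \<inter> S))"
    proof (intro iffI ballI)
      fix A assume H: "\<forall>A\<in>\<A>. finite (J \<inter> A) \<and> card (J \<inter> A) \<le> c A" and "A \<in> \<A>"
      then obtain A' where "A' \<in> \<A>" "A' \<inter> S = A \<inter> S" "c A' = d (A \<inter> S)"
        using d_eq by blast
      then show "finite (J \<inter> (A \<inter> S)) \<and> card (J \<inter> (A \<inter> S)) \<le> d (A \<inter> S)"
        using H *[of A'] by metis
    next
      fix A assume "\<forall>A\<in>\<A>. finite (J \<inter> (A \<inter> S)) \<and> card (J \<inter> (A \<inter> S)) \<le> d (A \<inter> S)" and "A \<in> \<A>"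
      then show "finite (J \<inter> A) \<and> card (J \<inter> A) \<le> c A"
        using d_le[of A] *[of A] by (metis order_trans)
    qed
    then show ?thesis
      using True by (auto simp: restriction_def I \<B>_def)
  qed (auto simp: restriction_def)
  ultimately show ?thesis
    using matroid_restriction[OF M] unfolding laminar_matroid_def by blast
qed

lemma laminar_class_prefix:
  assumes "M \<in> laminar_class n" and "matroid_ordering M \<pi>" and "prefix_restriction M' \<pi>' M \<pi>"
  shows "M' \<in> laminar_class n" and "matroid_ordering M' \<pi>'"
proof -
  obtain m where m: "m < card (ground M)" and M': "M' = restriction M (\<pi> ` {1..m})"
    and \<pi>': "\<pi>' = restrict \<pi> {1..m}"
    using assms(3) by (auto simp: prefix_restriction_def)
  have fin: "finite (ground M)" and bij: "bij_betw \<pi> {1..card (ground M)} (ground M)"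
    using assms(2) by (auto simp: matroid_ordering_def)
  have sub: "{1..m} \<subseteq> {1..card (ground M)}" using m by auto
  have g: "ground M' = \<pi> ` {1..m}"
    using bij sub by (fastforce simp: M' restriction_def bij_betw_def)
  have inj: "inj_on \<pi> {1..m}"
    using bij sub by (meson bij_betw_def inj_on_subset)
  have c: "card (ground M') = m"
    using inj g by (simp add: card_image)
  show "M' \<in> laminar_class n"
    using assms(1) c m laminar_matroid_restriction[of M] g unfolding laminar_class_def
    by (auto simp: M')
  have "bij_betw \<pi>' {1..m} (ground M')"
    unfolding \<pi>' g bij_betw_restrict_eq using inj by (rule inj_on_imp_bij_betw)
  then show "matroid_ordering M' \<pi>'"
    unfolding matroid_ordering_def c by (simp add: g \<pi>')
qed

lemma matroid_complete_linear: "matroid (complete_linear_matroid :: ('f::field ^ 'n) matroid)"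
proof
  fix I J :: "('f ^ 'n) set"
  assume I: "I \<in> indeps complete_linear_matroid" and J: "J \<in> indeps complete_linear_matroid"
    and less: "card I < card J"
  have "\<not> J \<subseteq> vec.span I"
    using I J less vec.independent_span_bound[of I J]
    by (auto simp: complete_linear_matroid_def vec.finiteI_independent)
  then obtain x where x: "x \<in> J" "x \<notin> vec.span I" by blast
  then have "x \<notin> I" using vec.span_base by blast
  with x I show "\<exists>x\<in>J - I. insert x I \<in> indeps complete_linear_matroid"
    by (auto simp: complete_linear_matroid_def vec.independent_insert)
next
  show "\<exists>r. \<forall>I\<in>indeps (complete_linear_matroid :: ('f ^ 'n) matroid). finite I \<and> card I \<le> r"
    using vec.independent_card_le_dim[OF subset_UNIV]
    by (auto simp: complete_linear_matroid_def vec.finiteI_independent)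
next
  fix I J :: "('f ^ 'n) set"
  assume "I \<in> indeps complete_linear_matroid" "J \<subseteq> I"
  then show "J \<in> indeps complete_linear_matroid"
    by (auto simp: complete_linear_matroid_def dest: vec.dependent_mono)
qed (auto simp: complete_linear_matroid_def vec.independent_empty)

lemma mrank_complete_linear:
  "mrank (complete_linear_matroid :: ('f::field ^ 'n) matroid) S = vec.dim S"
  unfolding mrank_def
proof (rule Max_eqI)
  let ?X = "{I \<in> indeps (complete_linear_matroid :: ('f ^ 'n) matroid). I \<subseteq> S}"
  have le: "card I \<le> vec.dim S" if "I \<in> ?X" for I
    using that vec.independent_card_le_dim[of I S] by (auto simp: complete_linear_matroid_def)
  then have "card ` ?X \<subseteq> {..vec.dim S}" by auto
  then show "finite (card ` ?X)" using finite_subset by blast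
  show "y \<le> vec.dim S" if "y \<in> card ` ?X" for y using that le by auto
  obtain B where "B \<subseteq> S" "vec.independent B" "card B = vec.dim S"
    using vec.basis_exists[of S] by metis
  then show "vec.dim S \<in> card ` ?X"
    by (auto simp: complete_linear_matroid_def image_iff)
qed

end

theory Submission
  imports Defs
begin

text \<open>
  In a laminar matroid, let \<open>A\<close> be the smallest member of the laminar family that contains \<open>x\<close> and
  can be filled to capacity by an independent set of earlier elements. Then \<open>x\<close> lies in the closure
  of a set of earlier elements exactly when all earlier elements of \<open>A\<close> do (and \<open>x\<close> is a coloop if
  there is no such \<open>A\<close>). Hence, whatever vectors have been chosen so far, \<open>x\<close> can be represented by
  a generic vector of the span of \<open>A\<close>: one that avoids the spans of the at most \<open>2\<^sup>n\<^sup>-\<^sup>1\<close> sets of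
  earlier vectors that do not contain the span of \<open>A\<close>. No knowledge of the future is needed.
\<close>

section \<open>Avoiding finitely many subspaces over a large field\<close>

text \<open>Induction on the number of subspaces. If \<open>w\<close> avoids all of them but the new
  one \<open>U\<close>, move along the line \<open>u + t w\<close> with \<open>u\<close> in
  \<open>W - U\<close>: it misses \<open>U\<close> altogether and meets each other subspace at most
  once, since two meetings would put a nonzero multiple of \<open>w\<close> into it.\<close>

lemma (in vector_space) subspace_avoiding_subspaces:
  assumes "finite \<S>" and "\<And>U. U \<in> \<S> \<Longrightarrow> subspace U \<and> \<not> W \<subseteq> U" and "subspace W"
    and "infinite (UNIV :: 'a set) \<or> card \<S> \<le> card (UNIV :: 'a set)"
  shows "\<exists>w\<in>W. \<forall>U\<in>\<S>. w \<notin> U"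
  using assms
proof (induction \<S> rule: finite_induct)
  case empty
  then show ?case using subspace_0 by auto
next
  case (insert U \<S>)
  have "infinite (UNIV :: 'a set) \<or> card \<S> \<le> card (UNIV :: 'a set)"
    using insert.prems(3) insert.hyps by auto
  then obtain w where w: "w \<in> W" "\<forall>V\<in>\<S>. w \<notin> V"
    using insert by auto
  show ?case
  proof (cases "w \<in> U")
    case True
    obtain u where u: "u \<in> W" "u \<notin> U" using insert.prems(1)[of U] by auto
    have sU: "subspace U" using insert.prems(1) by auto
    define bad where "bad V = {t. u + scale t w \<in> V}" for V
    have bad: "finite (bad V) \<and> card (bad V) \<le> 1" if "V \<in> \<S>" for V
    proof -
      have sV: "subspace V" using that insert.prems(1) by auto
      have "t = t'" if tt: "t \<in> bad V" "t' \<in> bad V" for t t'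
      proof (rule ccontr)
        assume ne: "t \<noteq> t'"
        have "scale (t - t') w \<in> V"
          using subspace_diff[OF sV, of "u + scale t w" "u + scale t' w"] tt
          by (simp add: bad_def scale_left_diff_distrib)
        from subspace_scale[OF sV this, of "inverse (t - t')"] have "w \<in> V"
          using ne by simp
        then show False using w \<open>V \<in> \<S>\<close> by auto
      qed
      then have "bad V \<subseteq> {SOME t. t \<in> bad V}" by (metis singletonI someI subsetI)
      then show ?thesis by (metis card.empty card_insert_disjoint empty_iff finite.emptyI
          finite.insertI finite_subset card_mono One_nat_def)
    qed
    have "finite (\<Union>V\<in>\<S>. bad V)" using bad insert.hyps by blast
    moreover have "card (\<Union>V\<in>\<S>. bad V) \<le> card \<S>"
      using card_UN_le[OF insert.hyps(1), of bad] sum_bounded_above[of \<S> "\<lambda>V. card (bad V)" 1] bad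
      by force
    \<comment> \<open>There are at most \<open>card \<S>\<close> bad parameters, one less than the
      number of subspaces, so a field with \<open>card (insert U \<S>)\<close> elements still has a
      good one. Over an infinite field, finiteness of the bad set suffices.\<close>
    moreover have "card (insert U \<S>) = Suc (card \<S>)" using insert.hyps by simp
    ultimately have "(\<Union>V\<in>\<S>. bad V) \<noteq> UNIV"
      using insert.prems(3) by (metis not_less_eq_eq order_trans)
    then obtain t where t: "\<forall>V\<in>\<S>. u + scale t w \<notin> V" by (auto simp: bad_def)
    have "u + scale t w \<notin> U"
      using u True sU subspace_diff[OF sU, of "u + scale t w" "scale t w"] subspace_scale
      by auto
    moreover have "u + scale t w \<in> W"
      using u w insert.prems(2) by (simp add: subspace_add subspace_scale)
    ultimately show ?thesis using t by blast
  qed (use w in auto)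
qed

section \<open>Rank and bases\<close>

context matroid
begin

lemma card_le_mrank:
  assumes "I \<in> indeps M" and "I \<subseteq> S"
  shows "card I \<le> mrank M S"
proof -
  obtain r where "\<forall>I\<in>indeps M. finite I \<and> card I \<le> r" using finite_rank by blast
  then have "card ` {I \<in> indeps M. I \<subseteq> S} \<subseteq> {..r}" by auto
  then have "finite (card ` {I \<in> indeps M. I \<subseteq> S})" using finite_subset by blast
  then show ?thesis unfolding mrank_def using assms by (intro Max_ge) auto
qed

lemma mrank_basis:
  obtains I where "I \<in> indeps M" "I \<subseteq> S" "card I = mrank M S"
proof -
  obtain r where "\<forall>I\<in>indeps M. finite I \<and> card I \<le> r" using finite_rank by blast
  then have "card ` {I \<in> indeps M. I \<subseteq> S} \<subseteq> {..r}" by auto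
  then have "finite (card ` {I \<in> indeps M. I \<subseteq> S})" using finite_subset by blast
  then have "mrank M S \<in> card ` {I \<in> indeps M. I \<subseteq> S}"
    unfolding mrank_def using indep_empty by (intro Max_in) auto
  then show ?thesis using that by auto
qed

lemma finite_indep: "I \<in> indeps M \<Longrightarrow> finite I"
  using finite_rank by blast

lemma mrank_mono:
  assumes "S \<subseteq> T"
  shows "mrank M S \<le> mrank M T"
proof -
  obtain I where "I \<in> indeps M" "I \<subseteq> S" "card I = mrank M S" by (rule mrank_basis)
  then show ?thesis using card_le_mrank[of I T] assms by auto
qed

text \<open>If the rank grows, a basis \<open>J\<close> of the larger set must contain
  \<open>x\<close>, and \<open>J - {x}\<close> is a basis of \<open>S\<close> that \<open>x\<close>
  extends. Rank questions thus become questions about extending bases.\<close>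

lemma mrank_insert:
  assumes "x \<notin> S"
  shows "mrank M (insert x S) =
    (if \<exists>I\<in>indeps M. I \<subseteq> S \<and> card I = mrank M S \<and> insert x I \<in> indeps M
     then Suc (mrank M S) else mrank M S)"
proof -
  obtain J where J: "J \<in> indeps M" "J \<subseteq> insert x S" "card J = mrank M (insert x S)"
    by (rule mrank_basis)
  have Jx: "J - {x} \<in> indeps M" "J - {x} \<subseteq> S" using J indep_mono by auto
  then have le: "card (J - {x}) \<le> mrank M S" by (rule card_le_mrank)
  have c: "card J \<le> Suc (card (J - {x}))"
    using finite_indep[OF J(1)] by (cases "x \<in> J") simp_all
  have ge: "mrank M S \<le> mrank M (insert x S)" by (rule mrank_mono) auto
  show ?thesis
  proof (cases "\<exists>I\<in>indeps M. I \<subseteq> S \<and> card I = mrank M S \<and> insert x I \<in> indeps M")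
    case True
    then obtain I where I: "I \<in> indeps M" "I \<subseteq> S" "card I = mrank M S" "insert x I \<in> indeps M"
      by blast
    then have "Suc (mrank M S) \<le> mrank M (insert x S)"
      using card_le_mrank[of "insert x I" "insert x S"] assms finite_indep[of I]
      by (metis card_insert_disjoint insert_mono subsetD)
    then show ?thesis using True le c J(3) by auto
  next
    case False
    have "mrank M (insert x S) = mrank M S"
    proof (rule ccontr)
      assume "mrank M (insert x S) \<noteq> mrank M S"
      then have *: "card (J - {x}) = mrank M S" "card J = Suc (mrank M S)" using ge le c J(3) by auto
      then have "x \<in> J" by (cases "x \<in> J") auto
      then have "insert x (J - {x}) \<in> indeps M" using J(1) by (simp add: insert_absorb)
      then show False using False Jx * by blast
    qed
    then show ?thesis using False by auto
  qed
qed

end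

lemma mrank_restriction: "S \<subseteq> T \<Longrightarrow> mrank (restriction M T) S = mrank M S"
  unfolding mrank_def restriction_def by (rule arg_cong[of _ _ "\<lambda>X. Max (card ` X)"]) auto

section \<open>One-element extensions of laminar matroids\<close>

text \<open>The second alternative says that \<open>x\<close> is placed freely on the flat spanned
  by \<open>D\<close> (a principal extension). The witness is \<open>D = A \<inter> E\<close> for
  the least tight set \<open>A\<close>; the first alternative arises when no set is tight.\<close>

lemma laminar_matroid_extension:
  fixes M :: "'a matroid"
  assumes "laminar_matroid M" and fin: "finite (ground M)" and x: "x \<in> ground M"
    and E: "E \<subseteq> ground M" and xE: "x \<notin> E"
  shows "(\<forall>S\<subseteq>E. mrank M (insert x S) = Suc (mrank M S)) \<or>
    (\<exists>D\<subseteq>E. \<forall>S\<subseteq>E. mrank M (insert x S) =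
       (if mrank M (S \<union> D) = mrank M S then mrank M S else Suc (mrank M S)))"
proof -
  obtain \<A> and c :: "'a set \<Rightarrow> nat" where AM: "\<A> \<subseteq> Pow (ground M)" and lam: "laminar_family \<A>"
    and ind: "indeps M = {I. I \<subseteq> ground M \<and> (\<forall>A\<in>\<A>. finite (I \<inter> A) \<and> card (I \<inter> A) \<le> c A)}"
    and "matroid M"
    using assms(1) unfolding laminar_matroid_def by blast
  interpret matroid M by fact
  have finI: "finite (I \<inter> B)" if "I \<in> indeps M" for I B
    using finite_indep[OF that] by simp
  have indD: "card (I \<inter> B) \<le> c B" if "I \<in> indeps M" "B \<in> \<A>" for I B
    using that ind by auto
  \<comment> \<open>Adding \<open>y\<close> raises only the counts of sets containing
    \<open>y\<close>, each by at most one, so only a set that contains \<open>y\<close> and is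
    already full can block it. \<open>no_room\<close> is the converse.\<close>
  have violated: "\<exists>B\<in>\<A>. y \<in> B \<and> c B \<le> card (I \<inter> B)"
    if I: "I \<in> indeps M" and y: "y \<in> ground M" and dep: "insert y I \<notin> indeps M" for y I
  proof -
    have "insert y I \<subseteq> ground M" using I y indep_subset_ground by auto
    then obtain B where B: "B \<in> \<A>" "\<not> (finite (insert y I \<inter> B) \<and> card (insert y I \<inter> B) \<le> c B)"
      using dep ind by blast
    have "finite (insert y I \<inter> B)" using finite_indep[OF I] by simp
    then have gt: "c B < card (insert y I \<inter> B)" using B by auto
    have "y \<in> B" using gt indD[OF I B(1)] by (cases "y \<in> B") auto
    then have "card (insert y I \<inter> B) \<le> Suc (card (I \<inter> B))"
      using finI[OF I] by (simp add: card_insert_if)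
    then show ?thesis using gt B(1) \<open>y \<in> B\<close> by (metis less_Suc_eq_le order_less_le_trans)
  qed
  have no_room: "insert y I \<notin> indeps M"
    if "I \<in> indeps M" "y \<notin> I" "y \<in> B" "B \<in> \<A>" "c B \<le> card (I \<inter> B)" for y I B
    using that indD[of "insert y I" B] finI[of I B] by (auto simp: card_insert_if)
  \<comment> \<open>By \<open>indD\<close> the last inequality is an equality: \<open>I\<close>
    fills \<open>A\<close>. Only such sets can block \<open>x\<close> from an independent subset of
    \<open>E\<close>.\<close>
  define tight where "tight = {A \<in> \<A>. x \<in> A \<and> (\<exists>I\<in>indeps M. I \<subseteq> E \<and> c A \<le> card (I \<inter> A))}"
  show ?thesis
  proof (cases "tight = {}")
    case True
    have "mrank M (insert x S) = Suc (mrank M S)" if S: "S \<subseteq> E" for S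
    proof -
      obtain I where I: "I \<in> indeps M" "I \<subseteq> S" "card I = mrank M S" by (rule mrank_basis)
      have "insert x I \<in> indeps M"
        using violated[OF I(1) x] True I S by (auto simp: tight_def)
      then have "\<exists>I\<in>indeps M. I \<subseteq> S \<and> card I = mrank M S \<and> insert x I \<in> indeps M"
        using I by blast
      moreover have "x \<notin> S" using S xE by auto
      ultimately show ?thesis by (simp only: mrank_insert if_True simp_thms)
    qed
    then show ?thesis by blast
  next
    case False
    have finT: "finite tight"
      using finite_subset[OF AM] fin unfolding tight_def by auto
    define A where "A = arg_min_on card tight"
    have A: "A \<in> tight" and minA: "\<And>B. B \<in> tight \<Longrightarrow> card A \<le> card B"
      unfolding A_def using arg_min_if_finite[OF finT False, of card]
      by (auto simp: not_less)
    have AinA: "A \<in> \<A>" and xA: "x \<in> A" using A by (auto simp: tight_def)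
    \<comment> \<open>Tight sets share \<open>x\<close>, so laminarity makes them a chain, and least
      cardinality implies least under inclusion.\<close>
    have least: "A \<subseteq> B" if B: "B \<in> tight" for B
    proof -
      have "A \<inter> B \<noteq> {}" "B \<in> \<A>" using A B by (auto simp: tight_def)
      then have "A \<subseteq> B \<or> B \<subseteq> A" using lam AinA unfolding laminar_family_def by blast
      moreover have "finite A" using AinA AM fin finite_subset[of A "ground M"] by auto
      ultimately show ?thesis using minA[OF B] card_seteq by blast
    qed
    obtain I0 where I0: "I0 \<in> indeps M" "I0 \<subseteq> E" "c A \<le> card (I0 \<inter> A)"
      using A by (auto simp: tight_def)
    have "mrank M (insert x S) =
       (if mrank M (S \<union> (A \<inter> E)) = mrank M S then mrank M S else Suc (mrank M S))"
      if S: "S \<subseteq> E" for S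
    proof (cases "mrank M (S \<union> (A \<inter> E)) = mrank M S")
      case True
      \<comment> \<open>Suppose \<open>x\<close> extends a basis \<open>I\<close> of
        \<open>S\<close>. Then \<open>I\<close> leaves room in \<open>A\<close> while
        \<open>I0\<close> fills it, so \<open>I \<inter> A\<close> can be augmented by some
        \<open>y\<close> from \<open>I0 \<inter> A\<close>. By the rank equality \<open>y\<close>
        cannot extend \<open>I\<close> itself, so some full set \<open>B\<close> blocks it.\<close>
      have no_basis: False
        if I: "I \<in> indeps M" "I \<subseteq> S" "card I = mrank M S" "insert x I \<in> indeps M" for I
      proof -
        have xI: "x \<notin> I" using I S xE by auto
        have IA: "I \<inter> A \<in> indeps M" using I(1) indep_mono by blast
        have "card (I \<inter> A) < card (I0 \<inter> A)"
          using no_room[OF I(1) xI xA AinA] I(4) I0(3) by linarith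
        moreover have "I0 \<inter> A \<in> indeps M" using I0 indep_mono by blast
        ultimately obtain y where y: "y \<in> I0 \<inter> A - I \<inter> A" "insert y (I \<inter> A) \<in> indeps M"
          using indep_augment[OF IA] by blast
        have "insert y I \<notin> indeps M"
        proof
          assume "insert y I \<in> indeps M"
          then have "card (insert y I) \<le> mrank M (S \<union> (A \<inter> E))"
            by (rule card_le_mrank) (use y I0 I in auto)
          then show False using True I(3) y finite_indep[OF I(1)] by (auto simp: card_insert_if)
        qed
        moreover have "y \<in> ground M" using y I0 E by auto
        ultimately obtain B where B: "B \<in> \<A>" "y \<in> B" "c B \<le> card (I \<inter> B)"
          using violated[OF I(1)] by blast
        \<comment> \<open>\<open>B\<close> blocks \<open>y\<close> but not \<open>x\<close>, and it
          meets \<open>A\<close> in \<open>y\<close>, so laminarity forces \<open>B\<close> inside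
          \<open>A\<close>. Then \<open>I \<inter> A\<close> already fills \<open>B\<close>, and
          \<open>y\<close> could not have augmented it.\<close>
        have "x \<notin> B" using no_room[OF I(1) xI _ B(1) B(3)] I(4) by blast
        then have "B \<subseteq> A"
          using lam B AinA xA y unfolding laminar_family_def by blast
        then have "(I \<inter> A) \<inter> B = I \<inter> B" by auto
        then show False using no_room[OF IA _ B(2) B(1)] y B(3) by auto
      qed
      have "x \<notin> S" using S xE by auto
      then show ?thesis using mrank_insert[of x S] True no_basis by metis
    next
      case False
      obtain I where I: "I \<in> indeps M" "I \<subseteq> S" "card I = mrank M S" by (rule mrank_basis)
      obtain J where J: "J \<in> indeps M" "J \<subseteq> S \<union> (A \<inter> E)" "card J = mrank M (S \<union> (A \<inter> E))"
        by (rule mrank_basis)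
      have "card I < card J"
        using False I(3) J(3) mrank_mono[of S "S \<union> (A \<inter> E)"] by auto
      then obtain y where y: "y \<in> J - I" "insert y I \<in> indeps M"
        using indep_augment[OF I(1) J(1)] by blast
      have "y \<notin> S"
        using card_le_mrank[OF y(2), of S] I y finite_indep[OF I(1)] by (auto simp: card_insert_if)
      then have yA: "y \<in> A" using y J by auto
      \<comment> \<open>A full set blocking \<open>x\<close> would be tight, hence contain
        \<open>A\<close> and with it \<open>y\<close>, so it would block \<open>y\<close> as
        well.\<close>
      have "insert x I \<in> indeps M"
      proof (rule ccontr)
        assume "insert x I \<notin> indeps M"
        then obtain B where B: "B \<in> \<A>" "x \<in> B" "c B \<le> card (I \<inter> B)"
          using violated[OF I(1) x] by blast
        then have "B \<in> tight" using I S by (auto simp: tight_def)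
        then have "y \<in> B" using least yA by auto
        then show False using no_room[OF I(1) _ _ B(1) B(3), of y] y by auto
      qed
      then have "\<exists>I\<in>indeps M. I \<subseteq> S \<and> card I = mrank M S \<and> insert x I \<in> indeps M"
        using I by blast
      moreover have "x \<notin> S" using S xE by auto
      ultimately show ?thesis using False by (simp only: mrank_insert if_True if_False simp_thms)
    qed
    then show ?thesis by (metis inf_le2)
  qed
qed

section \<open>Representing one further element\<close>

text \<open>Turns the rank condition of \<open>laminar_matroid_extension\<close> into containment in
  a span; in finite dimension, nested subspaces of equal dimension coincide.\<close>

lemma vec_dim_Un_eq_iff:
  fixes X Y :: "('f::field ^ 'n) set"
  shows "vec.dim (X \<union> Y) = vec.dim X \<longleftrightarrow> Y \<subseteq> vec.span X"
proof
  assume eq: "vec.dim (X \<union> Y) = vec.dim X"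
  have "vec.span X = vec.span (X \<union> Y)"
    by (rule vec.subspace_dim_equal) (auto simp: eq vec.span_mono)
  then show "Y \<subseteq> vec.span X" using vec.span_superset by blast
next
  assume "Y \<subseteq> vec.span X"
  then have "vec.span (X \<union> Y) = vec.span X"
    unfolding vec.span_eq using vec.span_superset[of X] vec.span_superset[of "X \<union> Y"] by auto
  then show "vec.dim (X \<union> Y) = vec.dim X" by (metis vec.dim_span)
qed

text \<open>One online step. As \<open>g\<close> is an arbitrary representation of the earlier
  elements, past choices never need revision. A coloop gets a vector outside the span of all of
  them, which exists because \<open>E\<close> has fewer than \<open>CARD('n)\<close>
  elements.\<close>

lemma laminar_representation_extension:
  fixes M :: "'a matroid" and g :: "'a \<Rightarrow> 'f::field ^ 'n::finite"
  assumes "infinite (UNIV :: 'f set) \<or> 2 ^ CARD('n) \<le> card (UNIV :: 'f set)"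
    and "laminar_matroid M" and "finite (ground M)" and "x \<in> ground M"
    and "E \<subseteq> ground M" and "x \<notin> E" and card: "card E < CARD('n)"
    and rep: "\<And>S. S \<subseteq> E \<Longrightarrow> vec.dim (g ` S) = mrank M S"
  shows "\<exists>v. \<forall>S\<subseteq>E. vec.dim (insert v (g ` S)) = mrank M (insert x S)"
proof -
  have finE: "finite E" using assms(3,5) finite_subset by blast
  consider (coloop) "\<forall>S\<subseteq>E. mrank M (insert x S) = Suc (mrank M S)"
    | (principal) D where "D \<subseteq> E" "\<forall>S\<subseteq>E. mrank M (insert x S) =
        (if mrank M (S \<union> D) = mrank M S then mrank M S else Suc (mrank M S))"
    using laminar_matroid_extension[OF assms(2-6)] by blast
  then show ?thesis
  proof cases
    case coloop
    have "vec.dim (g ` E) \<le> card (g ` E)" using finE by (intro vec.dim_le_card') auto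
    also have "\<dots> \<le> card E" using finE by (rule card_image_le)
    finally have "vec.dim (g ` E) < vec.dim (UNIV :: ('f ^ 'n) set)"
      using card by (simp add: card_cart_basis)
    then have "vec.span (g ` E) \<noteq> UNIV" by (metis less_irrefl vec.dim_span)
    then obtain v where v: "v \<notin> vec.span (g ` E)" by auto
    have "v \<notin> vec.span (g ` S)" if "S \<subseteq> E" for S
      using v vec.span_mono[of "g ` S" "g ` E"] that by auto
    then show ?thesis using coloop rep by (auto simp: vec.dim_insert)
  next
    case principal
    let ?W = "vec.span (g ` D)"
    \<comment> \<open>A span containing \<open>?W\<close> contains every \<open>v\<close> in
      \<open>?W\<close>, so only the other spans must be avoided.\<close>
    define \<S> where "\<S> = (\<lambda>S. vec.span (g ` S)) ` {S. S \<subseteq> E \<and> \<not> ?W \<subseteq> vec.span (g ` S)}"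
    have sub: "{S. S \<subseteq> E \<and> \<not> ?W \<subseteq> vec.span (g ` S)} \<subseteq> Pow E" by auto
    have fin: "finite \<S>" unfolding \<S>_def using finite_subset[OF sub] finE by simp
    have "card \<S> \<le> card {S. S \<subseteq> E \<and> \<not> ?W \<subseteq> vec.span (g ` S)}"
      unfolding \<S>_def using finite_subset[OF sub] finE by (intro card_image_le) simp
    also have "\<dots> \<le> 2 ^ card E" using card_mono[OF _ sub] finE by (simp add: card_Pow)
    also have "\<dots> \<le> 2 ^ CARD('n)" using card by (intro power_increasing) auto
    finally have "infinite (UNIV :: 'f set) \<or> card \<S> \<le> card (UNIV :: 'f set)"
      using assms(1) by auto
    then have "\<exists>v\<in>?W. \<forall>U\<in>\<S>. v \<notin> U"
      by (intro vec.subspace_avoiding_subspaces fin) (auto simp: \<S>_def)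
    then obtain v where v: "v \<in> ?W" "\<forall>U\<in>\<S>. v \<notin> U" by blast
    have "vec.dim (insert v (g ` S)) = mrank M (insert x S)" if S: "S \<subseteq> E" for S
    proof -
      \<comment> \<open>The chain carries membership of \<open>v\<close> in a span over to the
        matroid; its last link uses \<open>rep\<close> for both \<open>S\<close> and
        \<open>S \<union> D\<close>.\<close>
      have "v \<in> vec.span (g ` S) \<longleftrightarrow> ?W \<subseteq> vec.span (g ` S)"
        using v S by (auto simp: \<S>_def)
      also have "\<dots> \<longleftrightarrow> g ` D \<subseteq> vec.span (g ` S)"
        by (meson order_trans vec.span_minimal vec.span_superset vec.subspace_span)
      also have "\<dots> \<longleftrightarrow> vec.dim (g ` (S \<union> D)) = vec.dim (g ` S)"
        by (simp add: image_Un vec_dim_Un_eq_iff)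
      also have "\<dots> \<longleftrightarrow> mrank M (S \<union> D) = mrank M S"
        using rep S principal(1) by simp
      finally show ?thesis using principal(2) S rep[OF S] by (simp add: vec.dim_insert)
    qed
    then show ?thesis by blast
  qed
qed

section \<open>The greedy construction\<close>

text \<open>Stage \<open>k\<close> has placed the first \<open>k\<close> elements; all others sit at
  the default 0. The predicate under \<open>SOME\<close> sees only earlier vectors and ranks of sets
  of elements already revealed, which makes the choice online.\<close>

fun greedy_representation ::
  "'a matroid \<Rightarrow> (nat \<Rightarrow> 'a) \<Rightarrow> nat \<Rightarrow> 'a \<Rightarrow> 'f::field ^ 'n::finite" where
  "greedy_representation M \<pi> 0 = (\<lambda>_. 0)"
| "greedy_representation M \<pi> (Suc k) = (greedy_representation M \<pi> k)(\<pi> (Suc k) :=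
     SOME v. \<forall>S\<subseteq>\<pi> ` {1..k}. vec.dim (insert v (greedy_representation M \<pi> k ` S)) =
       mrank M (insert (\<pi> (Suc k)) S))"

lemma greedy_representation_cong:
  fixes M M' :: "'a matroid"
  assumes "\<And>S. S \<subseteq> \<pi> ` {1..k} \<Longrightarrow> mrank M' S = mrank M S" and "\<And>i. i \<in> {1..k} \<Longrightarrow> \<pi>' i = \<pi> i"
  shows "(greedy_representation M' \<pi>' k :: 'a \<Rightarrow> 'f::field ^ 'n::finite) =
    greedy_representation M \<pi> k"
  using assms
proof (induction k)
  case (Suc k)
  let ?G = "greedy_representation :: 'a matroid \<Rightarrow> _ \<Rightarrow> _ \<Rightarrow> 'a \<Rightarrow> 'f ^ 'n"
  have IH: "?G M' \<pi>' k = ?G M \<pi> k"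
  proof (rule Suc.IH)
    show "mrank M' S = mrank M S" if "S \<subseteq> \<pi> ` {1..k}" for S
      by (rule Suc.prems(1)) (use that in \<open>auto simp: atLeastAtMostSuc_conv\<close>)
    show "\<pi>' i = \<pi> i" if "i \<in> {1..k}" for i
      by (rule Suc.prems(2)) (use that in auto)
  qed
  have img: "\<pi>' ` {1..k} = \<pi> ` {1..k}" and last: "\<pi>' (Suc k) = \<pi> (Suc k)"
    using Suc.prems(2) by (auto intro!: image_cong)
  have "mrank M' (insert (\<pi> (Suc k)) S) = mrank M (insert (\<pi> (Suc k)) S)"
    if "S \<subseteq> \<pi> ` {1..k}" for S
    by (rule Suc.prems(1)) (use that in \<open>auto simp: atLeastAtMostSuc_conv\<close>)
  \<comment> \<open>\<open>SOME\<close> returns the same vector for both matroids once the two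
    predicates are equal as functions.\<close>
  then have "(\<lambda>v. \<forall>S\<subseteq>\<pi>' ` {1..k}. vec.dim (insert v (?G M' \<pi>' k ` S)) =
        mrank M' (insert (\<pi>' (Suc k)) S)) =
      (\<lambda>v. \<forall>S\<subseteq>\<pi> ` {1..k}. vec.dim (insert v (?G M \<pi> k ` S)) =
        mrank M (insert (\<pi> (Suc k)) S))"
    unfolding IH img last by (intro ext) auto
  then show ?case unfolding greedy_representation.simps IH last by simp
qed simp

text \<open>Later stages update only at later elements, which differ from \<open>\<pi> i\<close> by
  injectivity.\<close>

lemma greedy_representation_stable:
  assumes "inj_on \<pi> {1..m}" and "i \<in> {1..k}" and "k \<le> m"
  shows "greedy_representation M \<pi> m (\<pi> i) = greedy_representation M \<pi> k (\<pi> i)"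
  using assms(3,1)
proof (induction m rule: dec_induct)
  case (step m)
  have "\<pi> i \<noteq> \<pi> (Suc m)"
    using inj_onD[OF step.prems, of i "Suc m"] assms(2) step.hyps by auto
  moreover have "inj_on \<pi> {1..m}" using step.prems by (rule inj_on_subset) auto
  ultimately show ?case using step.IH by simp
qed simp

lemma dim_greedy_representation:
  fixes M :: "'a matroid"
  assumes "infinite (UNIV :: 'f::field set) \<or> 2 ^ CARD('n::finite) \<le> card (UNIV :: 'f set)"
    and "M \<in> laminar_class CARD('n)" and "matroid_ordering M \<pi>"
    and "k \<le> card (ground M)" and "S \<subseteq> \<pi> ` {1..k}"
  shows "vec.dim ((greedy_representation M \<pi> k :: 'a \<Rightarrow> 'f ^ 'n) ` S) = mrank M S"
  using assms(4,5)
proof (induction k arbitrary: S)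
  case 0
  have "matroid M" using assms(2) by (auto simp: laminar_class_def laminar_matroid_def)
  then interpret matroid M .
  have "{I \<in> indeps M. I = {}} = {{}}" using indep_empty by auto
  then have "mrank M {} = 0" by (simp add: mrank_def)
  then show ?case using 0 by simp
next
  case (Suc k)
  let ?g = "greedy_representation M \<pi> k :: 'a \<Rightarrow> 'f ^ 'n"
  let ?g' = "greedy_representation M \<pi> (Suc k) :: 'a \<Rightarrow> 'f ^ 'n"
  let ?x = "\<pi> (Suc k)" and ?E = "\<pi> ` {1..k}"
  have inj: "inj_on \<pi> {1..card (ground M)}" and im: "\<pi> ` {1..card (ground M)} = ground M"
    using assms(3) by (auto simp: matroid_ordering_def bij_betw_def)
  have M: "laminar_matroid M" "finite (ground M)" "card (ground M) \<le> CARD('n)"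
    using assms(2) by (auto simp: laminar_class_def)
  have xM: "?x \<in> ground M" and EM: "?E \<subseteq> ground M" using im Suc.prems(1) by auto
  have xE: "?x \<notin> ?E"
    using inj Suc.prems(1) by (auto dest!: inj_onD)
  have "card ?E \<le> k" using card_image_le[of "{1..k}" \<pi>] by simp
  then have cE: "card ?E < CARD('n)" using Suc.prems(1) M(3) by linarith
  have rep: "vec.dim (?g ` S) = mrank M S" if "S \<subseteq> ?E" for S
    using Suc.IH[OF _ that] Suc.prems(1) by simp
  \<comment> \<open>The induction hypothesis, as \<open>rep\<close>, makes the predicate under
    \<open>SOME\<close> satisfiable, so the chosen vector has the required property.\<close>
  have v: "\<forall>S\<subseteq>?E. vec.dim (insert (?g' ?x) (?g ` S)) = mrank M (insert ?x S)"
    using someI_ex[OF laminar_representation_extension[OF assms(1) M(1,2) xM EM xE cE rep]]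
    by simp
  have old: "?g' ` S = ?g ` S" if "S \<subseteq> ?E" for S
    using that xE by (intro image_cong) auto
  show ?case
  proof (cases "?x \<in> S")
    case True
    have sub: "S - {?x} \<subseteq> ?E" using Suc.prems(2) by (auto simp: atLeastAtMostSuc_conv)
    have "?g' ` S = insert (?g' ?x) (?g' ` (S - {?x}))" using True by blast
    also have "\<dots> = insert (?g' ?x) (?g ` (S - {?x}))" by (simp only: old[OF sub])
    finally have "vec.dim (?g' ` S) = mrank M (insert ?x (S - {?x}))" using v sub by metis
    then show ?thesis using True by (simp only: insert_Diff)
  next
    case False
    then have sub: "S \<subseteq> ?E" using Suc.prems(2) by (auto simp: atLeastAtMostSuc_conv)
    show ?thesis by (simp only: old[OF sub] rep[OF sub])
  qed
qed

section \<open>Assembling the online morphism\<close>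

theorem theorem8:
  assumes "infinite (UNIV :: 'f::field set) \<or> 2 ^ CARD('n::finite) \<le> card (UNIV :: 'f set)"
  shows "\<exists>f. online_matroid_morphism
    (laminar_class CARD('n) :: 'a matroid set)
    (complete_linear_matroid :: ('f ^ 'n) matroid) f"
proof
  let ?G = "greedy_representation :: 'a matroid \<Rightarrow> _ \<Rightarrow> _ \<Rightarrow> 'a \<Rightarrow> 'f ^ 'n"
  let ?f = "\<lambda>M \<pi>. ?G M \<pi> (card (ground M))"
  show "online_matroid_morphism (laminar_class CARD('n)) complete_linear_matroid ?f"
    unfolding online_matroid_morphism_def
  proof (intro ballI allI impI conjI)
    fix M :: "'a matroid" and \<pi>
    assume M: "M \<in> laminar_class CARD('n)" and ord: "matroid_ordering M \<pi>"
    have inj: "inj_on \<pi> {1..card (ground M)}" and im: "\<pi> ` {1..card (ground M)} = ground M"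
      using ord by (auto simp: matroid_ordering_def bij_betw_def)
    show "matroid_morphism M complete_linear_matroid (?f M \<pi>)"
      using dim_greedy_representation[OF assms M ord order_refl] im
      by (simp add: matroid_morphism_def mrank_complete_linear)
        (simp add: complete_linear_matroid_def)
    fix M' \<pi>' x
    assume pre: "prefix_restriction M' \<pi>' M \<pi>" and x: "x \<in> ground M'"
    then obtain m where m: "m < card (ground M)" and M': "M' = restriction M (\<pi> ` {1..m})"
      and \<pi>': "\<pi>' = restrict \<pi> {1..m}"
      by (auto simp: prefix_restriction_def)
    have "\<pi> ` {1..m} \<subseteq> \<pi> ` {1..card (ground M)}" using m by (intro image_mono) auto
    then have g: "ground M' = \<pi> ` {1..m}"
      using im by (auto simp: M' restriction_def)
    have "inj_on \<pi> {1..m}" using inj m by (auto intro: inj_on_subset)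
    then have c: "card (ground M') = m" by (simp add: g card_image)
    \<comment> \<open>The run on the prefix stops at stage \<open>m\<close>, where it agrees with
      the run on \<open>M\<close>; the remaining stages for \<open>M\<close> leave the first
      \<open>m\<close> elements fixed.\<close>
    have "?G M' \<pi>' m = ?G M \<pi> m"
      by (rule greedy_representation_cong) (auto simp: M' \<pi>' mrank_restriction)
    moreover obtain i where i: "i \<in> {1..m}" "x = \<pi> i" using x g by blast
    have "?f M \<pi> (\<pi> i) = ?G M \<pi> m (\<pi> i)"
      by (rule greedy_representation_stable[OF inj i(1)]) (use m in simp)
    ultimately show "?f M' \<pi>' x = ?f M \<pi> x" using i(2) c by simp
  qed
qed

end
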